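(* Let $X$, $Y$ be Banach spaces. Then $n(\mathcal{L}(X,Y))\leq \min\{n(X),n(Y)\}$. Moreover, the same holds for every operator ideal $\mathcal{Z}$ in $\mathcal{L}(X,Y)$ endowed with the operator norm, that is, $n(\mathcal{Z})\leq \min\{n(X),n(Y)\}$.
   Context: Banach spaces are (nonzero) real or complex; $X$ and $Y$ are over the same field. $S_X$, $B_X$ denote the unit sphere and closed unit ball of $X$, $X^*$ its topological dual, $\mathcal{L}(X,Y)$ the Banach space of bounded linear operators from $X$ to $Y$ with the operator norm, and $\mathcal{L}(X)=\mathcal{L}(X,X)$. For $T\in\mathcal{L}(X)$ the numerical radius is $v(T)=\sup\{|x^*(Tx)| : x\in S_X,\ x^*\in S_{X^*},\ x^*(x)=1\}$. The numerical index of $X$ is $n(X)=\inf\{v(T): T\in\mathcal{L}(X),\ \|T\|=1\}$. An operator ideal in $\mathcal{L}(X,Y)$ is a closed subspace $\mathcal{Z}$ of $\mathcal{L}(X,Y)$ containing all finite-rank operators and such that $ATB\in\mathcal{Z}$ whenever $A\in\mathcal{L}(Y)$, $T\in\mathcal{Z}$ and $B\in\mathcal{L}(X)$. *)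

theory Defs
  imports "HOL-Analysis.Analysis"
begin

text \<open>
  The scalar field is a type variable of the following class, so that the real and the complex
  case are covered by one statement.
\<close>

class real_or_complex = real_normed_field +
  assumes real_or_complex:
    "(\<exists>h :: 'a \<Rightarrow> real. bij h \<and>
        (\<forall>x y. h (x + y) = h x + h y) \<and> (\<forall>x y. h (x * y) = h x * h y) \<and>
        (\<forall>r x. h (r *\<^sub>R x) = r *\<^sub>R h x) \<and> (\<forall>x. norm (h x) = norm x)) \<or>
     (\<exists>h :: 'a \<Rightarrow> complex. bij h \<and>
        (\<forall>x y. h (x + y) = h x + h y) \<and> (\<forall>x y. h (x * y) = h x * h y) \<and>
        (\<forall>r x. h (r *\<^sub>R x) = r *\<^sub>R h x) \<and> (\<forall>x. norm (h x) = norm x))"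

instance real :: real_or_complex
  by standard (rule disjI1, rule exI[of _ id], simp)

instance complex :: real_or_complex
  by standard (rule disjI2, rule exI[of _ id], simp)

text \<open>
  A nonzero Banach space over \<open>'k\<close>. Completeness, the norm and the underlying real space come
  from the class \<^class>\<open>banach\<close>; the scalar multiplication by \<open>'k\<close> extends the real one.
\<close>

locale banach_over = vector_space s
  for s :: "'k::real_or_complex \<Rightarrow> 'a::banach \<Rightarrow> 'a" +
  assumes norm_scale: "norm (s c x) = norm c * norm x"
    and scale_of_real: "s (of_real r) x = r *\<^sub>R x"
    and nonzero: "\<exists>x::'a. x \<noteq> 0"

text \<open>
  Since the numerical index is needed for an operator ideal, which is a subspace of a type and not
  a type, the following notions are relative to a subspace \<open>V\<close> (which is \<^term>\<open>UNIV\<close> for the spaces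
  \<open>X\<close> and \<open>Y\<close>). Maps on \<open>V\<close> are represented by total functions; their values outside \<open>V\<close> are never
  used.
\<close>

definition bounded_linear_on ::
  "('k \<Rightarrow> 'a \<Rightarrow> 'a) \<Rightarrow> ('k \<Rightarrow> 'b \<Rightarrow> 'b) \<Rightarrow> 'a::real_normed_vector set \<Rightarrow>
    ('a \<Rightarrow> 'b::real_normed_vector) \<Rightarrow> bool" where
  "bounded_linear_on s t V f \<longleftrightarrow>
    (\<forall>x\<in>V. \<forall>y\<in>V. f (x + y) = f x + f y) \<and>
    (\<forall>c. \<forall>x\<in>V. f (s c x) = t c (f x)) \<and>
    (\<exists>B. \<forall>x\<in>V. norm (f x) \<le> B * norm x)"

definition opnorm_on :: "'a::real_normed_vector set \<Rightarrow> ('a \<Rightarrow> 'b::real_normed_vector) \<Rightarrow> real" where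
  "opnorm_on V f = (SUP x\<in>{x\<in>V. norm x \<le> 1}. norm (f x))"

definition numerical_radius ::
  "('k::real_normed_field \<Rightarrow> 'a \<Rightarrow> 'a) \<Rightarrow> 'a::real_normed_vector set \<Rightarrow> ('a \<Rightarrow> 'a) \<Rightarrow> real" where
  "numerical_radius s V T =
    Sup {norm (f (T x)) | x f.
      x \<in> V \<and> norm x = 1 \<and> bounded_linear_on s (*) V f \<and> opnorm_on V f = 1 \<and> f x = 1}"

definition numerical_index ::
  "('k::real_normed_field \<Rightarrow> 'a \<Rightarrow> 'a) \<Rightarrow> 'a::real_normed_vector set \<Rightarrow> real" where
  "numerical_index s V =
    Inf {numerical_radius s V T | T.
      T ` V \<subseteq> V \<and> bounded_linear_on s s V T \<and> opnorm_on V T = 1}"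

text \<open>
  \<open>\<L>(X,Y)\<close> is the set of \<open>'k\<close>-linear elements of the type of bounded real-linear operators, with the
  norm of that type, and with the pointwise scalar multiplication.
\<close>

definition bounded_ops ::
  "('k \<Rightarrow> 'a \<Rightarrow> 'a) \<Rightarrow> ('k \<Rightarrow> 'b \<Rightarrow> 'b) \<Rightarrow>
    ('a::real_normed_vector \<Rightarrow>\<^sub>L 'b::real_normed_vector) set" where
  "bounded_ops s t = {T. \<forall>c x. blinfun_apply T (s c x) = t c (blinfun_apply T x)}"

definition op_scale ::
  "('k \<Rightarrow> 'b \<Rightarrow> 'b) \<Rightarrow> 'k \<Rightarrow> ('a::real_normed_vector \<Rightarrow>\<^sub>L 'b::real_normed_vector) \<Rightarrow>
    ('a \<Rightarrow>\<^sub>L 'b)" where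
  "op_scale t c T = Blinfun (\<lambda>x. t c (blinfun_apply T x))"

definition finite_rank ::
  "('k::real_normed_field \<Rightarrow> 'b \<Rightarrow> 'b) \<Rightarrow>
    ('a::real_normed_vector \<Rightarrow>\<^sub>L 'b::real_normed_vector) \<Rightarrow> bool" where
  "finite_rank t T \<longleftrightarrow> (\<exists>B. finite B \<and> range (blinfun_apply T) \<subseteq> module.span t B)"

definition operator_ideal ::
  "('k::real_normed_field \<Rightarrow> 'a \<Rightarrow> 'a) \<Rightarrow> ('k \<Rightarrow> 'b \<Rightarrow> 'b) \<Rightarrow>
    ('a::real_normed_vector \<Rightarrow>\<^sub>L 'b::real_normed_vector) set \<Rightarrow> bool" where
  "operator_ideal s t Z \<longleftrightarrow>
    Z \<subseteq> bounded_ops s t \<and> closed Z \<and> module.subspace (op_scale t) Z \<and>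
    {T \<in> bounded_ops s t. finite_rank t T} \<subseteq> Z \<and>
    (\<forall>A \<in> bounded_ops t t. \<forall>T \<in> Z. \<forall>B \<in> bounded_ops s s. A o\<^sub>L T o\<^sub>L B \<in> Z)"

end

theory Submission
  imports Defs
begin

text \<open>
  An operator \<open>S\<close> of norm \<open>1\<close> on \<open>X\<close> acts on an ideal \<open>Z\<close> of operators from \<open>X\<close> to \<open>Y\<close> by
  \<open>T \<mapsto> T \<circ> S\<close>, and an operator \<open>S\<close> of norm \<open>1\<close> on \<open>Y\<close> acts on \<open>Z\<close> by \<open>T \<mapsto> S \<circ> T\<close>. Let \<open>\<Phi>\<close> be either
  action. It has norm \<open>1\<close>, as is seen on rank-one operators. Once the numerical radius of \<open>\<Phi>\<close> is
  known to be at most that of \<open>S\<close>, the numerical index of \<open>Z\<close> is at most the numerical radius of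
  every such \<open>S\<close>, and hence at most the numerical indices of \<open>X\<close> and of \<open>Y\<close>.

  The comparison of numerical radii is not immediate from the definition, since a functional on \<open>Z\<close>
  that supports some \<open>T\<close> need not come from a functional and a vector of the underlying spaces. It
  becomes immediate when the numerical radius is described by norms of operators only: by
  \<open>numerical_radius_le_iff\<close>, an operator \<open>S\<close> of norm at most \<open>1\<close> has numerical radius at most \<open>v\<close> iff
  \<open>(1 - \<bar>b\<bar> v) \<parallel>x + b S x\<parallel> \<le> (1 + \<bar>b\<bar>\<^sup>2) \<parallel>x\<parallel>\<close> for all scalars \<open>b\<close> and all \<open>x\<close>. This is a quantitative
  form of Lumer's theorem that the numerical radius can be computed from \<open>\<parallel>I + b S\<parallel>\<close> as \<open>b\<close> tends to
  \<open>0\<close>. The inequality passes from \<open>S\<close> to \<open>\<Phi>\<close> because \<open>T + b (\<Phi> T)\<close> is \<open>T \<circ> (I + b S)\<close> or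
  \<open>(I + b S) \<circ> T\<close> (\<open>numerical_index_le_of_transfer\<close>).

  Supporting functionals are needed throughout, on \<open>X\<close>, on \<open>Y\<close> and on \<open>Z\<close>, so the Hahn-Banach
  theorem over the real and the complex field is proved beforehand
  (\<open>exists_norming_functional\<close>).
\<close>

section \<open>Norming functionals\<close>

lemma INF_plus_INF_greatest:
  fixes f :: "'i \<Rightarrow> real" and g :: "'j \<Rightarrow> real"
  assumes "S \<noteq> {}" and "T \<noteq> {}" and le: "\<And>s t. s \<in> S \<Longrightarrow> t \<in> T \<Longrightarrow> c \<le> f s + g t"
  shows "c \<le> (INF s\<in>S. f s) + (INF t\<in>T. g t)"
proof -
  have "c - (INF t\<in>T. g t) \<le> f s" if "s \<in> S" for s
  proof -
    have "c - f s \<le> (INF t\<in>T. g t)"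
      using le[OF that] by (intro cINF_greatest \<open>T \<noteq> {}\<close>) (simp add: algebra_simps)
    then show ?thesis by simp
  qed
  then have "c - (INF t\<in>T. g t) \<le> (INF s\<in>S. f s)"
    by (intro cINF_greatest \<open>S \<noteq> {}\<close>)
  then show ?thesis by simp
qed

text \<open>
  The functions from which norming functionals are found: the linear ones among them are exactly
  the real-linear functionals of norm at most \<open>1\<close>.
\<close>

definition sublinear_below_norm :: "('a::real_normed_vector \<Rightarrow> real) \<Rightarrow> bool" where
  "sublinear_below_norm p \<longleftrightarrow>
    (\<forall>x y. p (x + y) \<le> p x + p y) \<and> (\<forall>r\<ge>0. \<forall>x. p (r *\<^sub>R x) = r * p x) \<and> (\<forall>x. p x \<le> norm x)"

lemma sublinear_below_normD:
  assumes "sublinear_below_norm p"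
  shows "p (x + y) \<le> p x + p y" and "r \<ge> 0 \<Longrightarrow> p (r *\<^sub>R x) = r * p x" and "p x \<le> norm x"
    and "p 0 = 0" and "- norm x \<le> p x"
proof -
  show *: "p (x + y) \<le> p x + p y" "r \<ge> 0 \<Longrightarrow> p (r *\<^sub>R x) = r * p x" "p x \<le> norm x" for r x y
    using assms by (auto simp: sublinear_below_norm_def)
  show z: "p 0 = 0"
    using *(2)[of 0 0] by simp
  show "- norm x \<le> p x"
    using *(1)[of x "- x"] *(3)[of "- x"] z by simp
qed

text \<open>
  Positive homogeneity follows from one of its two inequalities, since the scaling by \<open>r\<close> can be
  undone by \<open>1 / r\<close>; for infima of sublinear functions only this inequality is immediate.
\<close>

lemma sublinear_below_normI:
  assumes add: "\<And>x y. p (x + y) \<le> p x + p y"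
    and scale: "\<And>r x. r > 0 \<Longrightarrow> p (r *\<^sub>R x) \<le> r * p x"
    and norm: "\<And>x. p x \<le> norm x"
  shows "sublinear_below_norm p"
proof -
  have "p 0 = 0"
    using add[of 0 0] norm[of 0] by simp
  moreover have "p (r *\<^sub>R x) = r * p x" if "r > 0" for r x
  proof (rule antisym)
    have "p ((1 / r) *\<^sub>R r *\<^sub>R x) \<le> (1 / r) * p (r *\<^sub>R x)"
      using that by (intro scale) simp
    then show "r * p x \<le> p (r *\<^sub>R x)"
      using that by (simp add: field_simps)
  qed (fact scale[OF that])
  ultimately have "p (r *\<^sub>R x) = r * p x" if "r \<ge> 0" for r x
    using that by (cases "r = 0") auto
  then show ?thesis
    using add norm by (auto simp: sublinear_below_norm_def)
qed

text \<open>
  Pushing \<open>p\<close> down along the ray through \<open>y\<close> as far as subadditivity permits gives a sublinear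
  function that already satisfies the inequality at \<open>- y\<close> which a linear function must satisfy.
\<close>

lemma sublinear_below_norm_lower:
  fixes p :: "'a::real_normed_vector \<Rightarrow> real"
  assumes p: "sublinear_below_norm p"
  obtains q where "sublinear_below_norm q" and "q \<le> p" and "\<And>x. q x \<le> p (x + y) - p y"
proof -
  note [simp] = sublinear_below_normD(2,4)[OF p]
  define g where "g x t = p (x + t *\<^sub>R y) - t * p y" for x t
  define q where "q x = (INF t\<in>{0..}. g x t)" for x
  have "- p (- x) \<le> g x t" if "t \<ge> 0" for x t
    using sublinear_below_normD(1)[OF p, of "x + t *\<^sub>R y" "- x"] that by (simp add: g_def)
  then have bdd: "bdd_below (g x ` {0..})" for x
    by (intro bdd_belowI2[of _ "- p (- x)"]) simp
  have q_le: "q x \<le> g x t" if "t \<ge> 0" for x t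
    unfolding q_def using that by (intro cINF_lower bdd) simp
  have q_le_p: "q x \<le> p x" for x
    using q_le[of 0 x] by (simp add: g_def)
  have "sublinear_below_norm q"
  proof (rule sublinear_below_normI)
    fix x x'
    have "q (x + x') \<le> g x s + g x' t" if "s \<ge> 0" "t \<ge> 0" for s t
    proof -
      have "q (x + x') \<le> g (x + x') (s + t)"
        using that by (intro q_le) simp
      also have "\<dots> \<le> g x s + g x' t"
        using sublinear_below_normD(1)[OF p, of "x + s *\<^sub>R y" "x' + t *\<^sub>R y"]
        by (simp add: g_def algebra_simps)
      finally show ?thesis .
    qed
    then show "q (x + x') \<le> q x + q x'"
      unfolding q_def[of x] q_def[of x'] by (intro INF_plus_INF_greatest) auto
  next
    fix r :: real and x
    assume r: "r > 0"
    have "q (r *\<^sub>R x) / r \<le> g x t" if "t \<ge> 0" for t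
    proof -
      have "q (r *\<^sub>R x) \<le> g (r *\<^sub>R x) (r * t)"
        using r that by (intro q_le) simp
      also have "\<dots> = p (r *\<^sub>R (x + t *\<^sub>R y)) - r * (t * p y)"
        by (simp add: g_def scaleR_add_right)
      also have "\<dots> = r * g x t"
        using r by (simp add: g_def right_diff_distrib)
      finally show ?thesis
        using r by (simp add: field_simps)
    qed
    then have "q (r *\<^sub>R x) / r \<le> q x"
      unfolding q_def[of x] by (intro cINF_greatest) auto
    then show "q (r *\<^sub>R x) \<le> r * q x"
      using r by (simp add: field_simps)
  next
    show "q x \<le> norm x" for x
      using q_le_p[of x] sublinear_below_normD(3)[OF p, of x] by linarith
  qed
  moreover have "q \<le> p"
    using q_le_p by (simp add: le_fun_def)
  moreover have "q x \<le> p (x + y) - p y" for x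
    using q_le[of 1 x] by (simp add: g_def)
  ultimately show thesis
    by (rule that)
qed

text \<open>
  The infimum over a chain stays subadditive because two members \<open>p\<close> and \<open>q\<close> can be replaced by the
  smaller one before subadditivity is applied.
\<close>

lemma sublinear_below_norm_Inf_chain:
  assumes ne: "C \<noteq> {}" and sub: "\<And>p. p \<in> C \<Longrightarrow> sublinear_below_norm p"
    and chain: "\<And>p q. p \<in> C \<Longrightarrow> q \<in> C \<Longrightarrow> p \<le> q \<or> q \<le> p"
  shows "sublinear_below_norm (\<lambda>x. INF p\<in>C. p x)"
    and "\<And>p. p \<in> C \<Longrightarrow> (\<lambda>x. INF p\<in>C. p x) \<le> p"
proof -
  define u where "u x = (INF p\<in>C. p x)" for x
  have bdd: "bdd_below ((\<lambda>p. p x) ` C)" for x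
    using sublinear_below_normD(5)[OF sub] by (intro bdd_belowI2[of _ "- norm x"])
  have u_le: "u x \<le> p x" if "p \<in> C" for p x
    unfolding u_def using that by (intro cINF_lower bdd)
  have "sublinear_below_norm u"
  proof (rule sublinear_below_normI)
    fix x y
    have "u (x + y) \<le> p x + q y" if pq: "p \<in> C" "q \<in> C" for p q
    proof -
      obtain m where m: "m \<in> C" "m \<le> p" "m \<le> q"
        using chain[OF pq] pq by blast
      have "u (x + y) \<le> m (x + y)"
        by (rule u_le[OF m(1)])
      also have "\<dots> \<le> m x + m y"
        by (rule sublinear_below_normD(1)[OF sub[OF m(1)]])
      also have "\<dots> \<le> p x + q y"
        using m by (intro add_mono) (auto simp: le_fun_def)
      finally show ?thesis .
    qed
    then show "u (x + y) \<le> u x + u y"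
      unfolding u_def[of x] u_def[of y] by (intro INF_plus_INF_greatest ne)
  next
    fix r :: real and x
    assume r: "r > 0"
    have "u (r *\<^sub>R x) / r \<le> p x" if "p \<in> C" for p
      using u_le[OF that, of "r *\<^sub>R x"] sublinear_below_normD(2)[OF sub[OF that], of r x] r
      by (simp add: field_simps)
    then have "u (r *\<^sub>R x) / r \<le> u x"
      unfolding u_def[of x] by (intro cINF_greatest ne)
    then show "u (r *\<^sub>R x) \<le> r * u x"
      using r by (simp add: field_simps)
  next
    fix x
    obtain p where "p \<in> C" using ne by blast
    then show "u x \<le> norm x"
      using u_le[of p x] sublinear_below_normD(3)[OF sub, of p x] by linarith
  qed
  then show "sublinear_below_norm (\<lambda>x. INF p\<in>C. p x)"
    unfolding u_def .
  show "(\<lambda>x. INF p\<in>C. p x) \<le> p" if "p \<in> C" for p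
    using u_le[OF that] by (simp add: le_fun_def u_def)
qed

text \<open>
  Zorn's lemma. The members stay above \<open>\<lambda>x. - norm x\<close>, so that the infimum of a chain is finite and
  a lower bound of the chain.
\<close>

lemma minimal_sublinear_below_norm:
  assumes p0: "sublinear_below_norm p0"
  obtains p where "sublinear_below_norm p" and "p \<le> p0"
    and "\<And>q. sublinear_below_norm q \<Longrightarrow> q \<le> p \<Longrightarrow> q = p"
proof -
  let ?A = "{p. sublinear_below_norm p \<and> p \<le> p0}"
  let ?P = "\<lambda>p q. q \<le> p"
  have "\<exists>m\<in>?A. \<forall>a\<in>?A. ?P m a \<longrightarrow> a = m"
  proof (rule predicate_Zorn)
    show "partial_order_on ?A (relation_of ?P ?A)"
      by (rule partial_order_on_relation_ofI) auto
  next
    fix C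
    assume C: "C \<in> Chains (relation_of ?P ?A)"
    show "\<exists>u\<in>?A. \<forall>a\<in>C. ?P a u"
    proof (cases "C = {}")
      case True
      then show ?thesis using p0 by blast
    next
      case False
      have sub: "sublinear_below_norm p" "p \<le> p0" if "p \<in> C" for p
        using C that by (auto simp: Chains_def relation_of_def)
      have chain: "p \<le> q \<or> q \<le> p" if "p \<in> C" "q \<in> C" for p q
        using C that by (auto simp: Chains_def relation_of_def)
      obtain c where "c \<in> C" using False by blast
      show ?thesis
        using sublinear_below_norm_Inf_chain[OF False sub(1) chain] sub(2)[OF \<open>c \<in> C\<close>] \<open>c \<in> C\<close>
        by (intro bexI[of _ "\<lambda>x. INF p\<in>C. p x"]) (auto intro: order_trans)
    qed
  qed
  then obtain p where p: "p \<in> ?A" and min: "\<forall>a\<in>?A. a \<le> p \<longrightarrow> a = p"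
    by blast
  then have "q = p" if "sublinear_below_norm q" "q \<le> p" for q
    using that order_trans[OF that(2), of p0] by blast
  with p show thesis
    by (intro that) auto
qed

text \<open>
  Hahn-Banach over the reals. A minimal sublinear function is linear, since lowering it along any
  \<open>y\<close> leaves it unchanged and therefore \<open>u x + u y \<le> u (x + y)\<close>. To get the right value at \<open>x0\<close>, the
  norm is first lowered along \<open>x0\<close>: below the result every linear \<open>u\<close> has \<open>u (- x0) \<le> - norm x0\<close>.
\<close>

lemma exists_real_norming_functional:
  fixes x0 :: "'a::real_normed_vector"
  obtains u :: "'a \<Rightarrow> real" where "linear u" and "\<And>x. u x \<le> norm x" and "u x0 = norm x0"
proof -
  have "sublinear_below_norm (norm :: 'a \<Rightarrow> real)"
    by (rule sublinear_below_normI) (auto simp: norm_triangle_ineq)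
  then obtain p0 :: "'a \<Rightarrow> real" where p0: "sublinear_below_norm p0"
      "\<And>x. p0 x \<le> norm (x + x0) - norm x0"
    by (rule sublinear_below_norm_lower[where y = x0]) blast
  obtain u where u: "sublinear_below_norm u" "u \<le> p0"
      and min: "\<And>q. sublinear_below_norm q \<Longrightarrow> q \<le> u \<Longrightarrow> q = u"
    using minimal_sublinear_below_norm[OF p0(1)] by blast
  have add: "u (x + y) = u x + u y" for x y
  proof (rule antisym)
    obtain q where "sublinear_below_norm q" "q \<le> u" "\<And>x. q x \<le> u (x + y) - u y"
      by (rule sublinear_below_norm_lower[OF u(1), where y = y]) blast
    with min[of q] have "u x \<le> u (x + y) - u y"
      by metis
    then show "u x + u y \<le> u (x + y)" by simp
  qed (rule sublinear_below_normD(1)[OF u(1)])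
  have minus: "u (- x) = - u x" for x
    using add[of x "- x"] sublinear_below_normD(4)[OF u(1)] by simp
  have "u (r *\<^sub>R x) = r * u x" for r x
    using sublinear_below_normD(2)[OF u(1), of r x] sublinear_below_normD(2)[OF u(1), of "- r" x]
    by (cases "r \<ge> 0") (auto simp: minus)
  with add have "linear u"
    by (intro linearI) auto
  moreover have "u x0 = norm x0"
  proof (rule antisym)
    have "u (- x0) \<le> - norm x0"
      using u(2) p0(2)[of "- x0"] by (simp add: le_fun_def) (metis order_trans)
    then show "norm x0 \<le> u x0" by (simp add: minus)
  qed (rule sublinear_below_normD(3)[OF u(1)])
  ultimately show thesis
    using sublinear_below_normD(3)[OF u(1)] that by blast
qed

text \<open>
  The only facts about the scalar field that depend on its being real or complex; they are what the
  passage from real to \<open>'k\<close>-linear functionals needs.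
\<close>

lemma real_or_complex_cases:
  obtains (real) "\<And>c :: 'k::real_or_complex. \<exists>r. c = of_real r"
    | (complex) i :: "'k::real_or_complex" where "i * i = - 1"
        and "\<And>c :: 'k::real_or_complex. \<exists>a b. c = of_real a + i * of_real b"
        and "\<And>a b. (norm (of_real a + i * of_real b))\<^sup>2 = a\<^sup>2 + b\<^sup>2"
proof -
  from real_or_complex[where 'a = 'k] show thesis
  proof (elim disjE exE conjE)
    fix h :: "'k \<Rightarrow> real"
    assume h: "bij h" "\<forall>x y. h (x * y) = h x * h y" "\<forall>r x. h (r *\<^sub>R x) = r *\<^sub>R h x"
    have inj: "h x = h y \<longleftrightarrow> x = y" for x y
      using h(1) by (simp add: bij_def inj_eq)
    have "h 0 = 0"
      using h(3)[rule_format, of 0 0] by simp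
    then have "h 1 = 1"
      using h(2)[rule_format, of 1 1] inj[of 1 0] by simp
    then have "h (of_real r) = r" for r
      using h(3) by (simp add: of_real_def)
    then have "c = of_real (h c)" for c
      by (simp flip: inj)
    then show thesis
      by (intro real) blast
  next
    fix h :: "'k \<Rightarrow> complex"
    assume h: "bij h" "\<forall>x y. h (x + y) = h x + h y" "\<forall>x y. h (x * y) = h x * h y"
      "\<forall>r x. h (r *\<^sub>R x) = r *\<^sub>R h x" "\<forall>x. norm (h x) = norm x"
    have inj: "h x = h y \<longleftrightarrow> x = y" for x y
      using h(1) by (simp add: bij_def inj_eq)
    have "h 0 = 0"
      using h(4)[rule_format, of 0 0] by simp
    then have "h 1 = 1"
      using h(3)[rule_format, of 1 1] inj[of 1 0] by simp
    then have h_of_real: "h (of_real r) = of_real r" for r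
      using h(4) by (simp add: of_real_def)
    obtain i where i: "h i = \<i>"
      using h(1) by (metis bij_pointE)
    have "h (i * i) = h (- 1)"
      using h(3) i h_of_real[of "- 1"] by simp
    moreover have hab: "h (of_real a + i * of_real b) = Complex a b" for a b
      using h(2,3) i h_of_real by (simp add: Complex_eq)
    then have "c = of_real (Re (h c)) + i * of_real (Im (h c))" for c
      by (simp flip: inj)
    moreover have "(norm (of_real a + i * of_real b))\<^sup>2 = a\<^sup>2 + b\<^sup>2" for a b
      using h(5) hab by (metis cmod_power2 complex.sel)
    ultimately show thesis
      by (intro complex[of i]) (auto simp: inj)
  qed
qed

lemma obtain_unimodular_rotation:
  fixes z :: "'k::real_normed_field"
  obtains c where "norm c = 1" and "c * z = of_real (norm z)"
proof (cases "z = 0")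
  case False
  then show thesis
    by (intro that[of "of_real (norm z) / z"]) (auto simp: norm_divide)
qed (auto intro: that[of 1])

context banach_over
begin

lemma scaleR_eq: "r *\<^sub>R x = s (of_real r) x"
  by (simp add: scale_of_real)

text \<open>
  Hahn-Banach over the scalar field. In the complex case \<open>u x - i u (i x)\<close> is the
  \<open>\<complex>\<close>-linear functional with real part \<open>u\<close>; its norm is that of \<open>u\<close> because its value can be
  rotated to a nonnegative real number, which is then a value of \<open>u\<close>.
\<close>

lemma exists_norming_functional:
  obtains f where "\<And>x y. f (x + y) = f x + f y" and "\<And>c x. f (s c x) = c * f x"
    and "\<And>x. norm (f x) \<le> norm x" and "f x0 = of_real (norm x0)"
proof -
  obtain u :: "'a \<Rightarrow> real" where u: "linear u" "\<And>x. u x \<le> norm x" "u x0 = norm x0"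
    using exists_real_norming_functional[of x0] by blast
  note add = linear_add[OF u(1)] and scaleR = linear_scale[OF u(1), simplified]
    and minus = linear_neg[OF u(1)]
  show thesis
  proof (cases rule: real_or_complex_cases[where 'k = 'k])
    case real
    have "\<bar>u x\<bar> \<le> norm x" for x
      using u(2)[of x] u(2)[of "- x"] by (simp add: minus)
    moreover have "of_real (u (s c x)) = c * of_real (u x)" for c x
      using real[of c] by (auto simp: scale_of_real scaleR)
    ultimately show thesis
      using u(3) by (intro that[of "\<lambda>x. of_real (u x)"]) (auto simp: add)
  next
    case (complex i)
    define f where "f x = of_real (u x) + i * of_real (- u (s i x))" for x
    have f_add: "f (x + y) = f x + f y" for x y
      by (simp add: f_def add scale_right_distrib algebra_simps)
    have f_real: "f (s (of_real r) x) = of_real r * f x" for r x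
    proof -
      have "s i (s (of_real r) x) = r *\<^sub>R s i x"
        by (simp add: scaleR_eq mult.commute)
      then show ?thesis
        by (simp add: f_def scaleR scale_of_real algebra_simps)
    qed
    have f_i: "f (s i x) = i * f x" for x
    proof -
      have "s i (s i x) = - x"
        using complex(1) by simp
      then show ?thesis
        using complex(1) by (simp add: f_def minus algebra_simps flip: mult.assoc)
    qed
    have f_scale: "f (s c x) = c * f x" for c x
    proof -
      obtain a b where c: "c = of_real a + i * of_real b"
        using complex(2) by blast
      have "s c x = s (of_real a) x + s i (s (of_real b) x)"
        by (simp add: c scale_left_distrib)
      then have "f (s c x) = of_real a * f x + i * (of_real b * f x)"
        by (simp only: f_add f_real f_i)
      then show ?thesis
        by (simp add: c algebra_simps)
    qed
    have norm_f: "(norm (f x))\<^sup>2 = (u x)\<^sup>2 + (u (s i x))\<^sup>2" for x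
      unfolding f_def using complex(3)[of "u x" "- u (s i x)"] by simp
    have f_le: "norm (f x) \<le> norm x" for x
    proof -
      obtain c where c: "norm c = 1" "c * f x = of_real (norm (f x))"
        by (rule obtain_unimodular_rotation)
      have "f (s c x) = of_real (norm (f x))"
        by (simp only: f_scale c(2))
      then have "of_real (u (s c x) - norm (f x)) + i * of_real (- u (s i (s c x))) = (0 :: 'k)"
        by (simp add: f_def[of "s c x"] algebra_simps del: scale_scale)
      then have "(u (s c x) - norm (f x))\<^sup>2 + (- u (s i (s c x)))\<^sup>2 = 0"
        by (simp only: norm_zero zero_power2 flip: complex(3))
      then have "norm (f x) = u (s c x)"
        by (simp add: sum_power2_eq_zero_iff)
      also have "\<dots> \<le> norm x"
        using u(2)[of "s c x"] by (simp add: norm_scale c(1))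
      finally show ?thesis .
    qed
    have "(norm (f x0))\<^sup>2 \<le> (norm x0)\<^sup>2"
      using f_le by (intro power_mono) auto
    then have "u (s i x0) = 0"
      using norm_f[of x0] u(3) by simp
    then have "f x0 = of_real (norm x0)"
      by (simp add: f_def u(3))
    then show thesis
      using that f_add f_scale f_le by blast
  qed
qed

end

section \<open>Operator norm, numerical radius and numerical index on a subspace\<close>

lemma opnorm_on_le:
  assumes "0 \<in> V" and "0 \<le> M" and le: "\<And>x. x \<in> V \<Longrightarrow> norm (f x) \<le> M * norm x"
  shows "opnorm_on V f \<le> M"
  unfolding opnorm_on_def
proof (rule cSUP_least)
  show "{x \<in> V. norm x \<le> 1} \<noteq> {}"
    using \<open>0 \<in> V\<close> by force
  show "norm (f x) \<le> M" if "x \<in> {x \<in> V. norm x \<le> 1}" for x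
    using that le[of x] mult_left_le[OF _ \<open>0 \<le> M\<close>, of "norm x"] by simp
qed

lemma norm_le_opnorm_on:
  assumes "bounded_linear_on s t V f" and "x \<in> V" and "norm x \<le> 1"
  shows "norm (f x) \<le> opnorm_on V f"
proof -
  obtain B where B: "\<And>x. x \<in> V \<Longrightarrow> norm (f x) \<le> B * norm x"
    using assms(1) unfolding bounded_linear_on_def by blast
  have "norm (f y) \<le> \<bar>B\<bar>" if "y \<in> V" "norm y \<le> 1" for y
  proof -
    have "B * norm y \<le> \<bar>B\<bar> * 1"
      using that by (intro mult_mono) auto
    then show ?thesis
      using B[OF that(1)] by simp
  qed
  then show ?thesis
    unfolding opnorm_on_def using assms(2,3)
    by (intro cSUP_upper bdd_aboveI2[of _ _ "\<bar>B\<bar>"]) auto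
qed

context banach_over
begin

lemma norm_le_opnorm_on_mult:
  assumes f: "bounded_linear_on s t V f" and norm_t: "\<And>c y. norm (t c y) = norm c * norm y"
    and V: "subspace V" and x: "x \<in> V"
  shows "norm (f x) \<le> opnorm_on V f * norm x"
proof (cases "x = 0")
  case True
  have "f (s 0 0) = t 0 (f 0)"
    using f subspace_0[OF V] unfolding bounded_linear_on_def by blast
  then have "norm (f 0) = 0"
    using norm_t[of 0 "f 0"] by simp
  with True show ?thesis by simp
next
  case False
  let ?c = "of_real (1 / norm x) :: 'k"
  have "norm (f (s ?c x)) \<le> opnorm_on V f"
    using V x False by (intro norm_le_opnorm_on[OF f] subspace_scale) (auto simp: norm_scale norm_divide)
  moreover have "f (s ?c x) = t ?c (f x)"
    using f x by (auto simp: bounded_linear_on_def)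
  ultimately show ?thesis
    using False by (simp add: norm_t norm_divide field_simps)
qed

text \<open>
  A norming functional for \<open>x\<close> on the whole space keeps its norm when it is restricted to \<open>V\<close>, since
  the norm is attained at \<open>x\<close>.
\<close>

lemma exists_supporting_functional_on:
  assumes "subspace V" and "x \<in> V" and "norm x = 1"
  obtains f where "bounded_linear_on s (*) V f" and "opnorm_on V f = 1" and "f x = 1"
proof -
  obtain f where f: "\<And>x y. f (x + y) = f x + f y" "\<And>c x. f (s c x) = c * f x"
      "\<And>x. norm (f x) \<le> norm x" "f x = of_real (norm x)"
    using exists_norming_functional[of x] by blast
  have bl: "bounded_linear_on s (*) V f"
    unfolding bounded_linear_on_def using f by (auto intro: exI[of _ 1])
  have "opnorm_on V f \<le> 1"
    using f(3) subspace_0[OF assms(1)] by (intro opnorm_on_le) auto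
  moreover have "1 \<le> opnorm_on V f"
    using norm_le_opnorm_on[OF bl, of x] assms f(4) by simp
  ultimately show thesis
    using bl f(4) assms(3) by (intro that[of f]) auto
qed

lemma exists_unit_vector_in:
  assumes V: "subspace V" "V \<noteq> {0}"
  obtains x where "x \<in> V" and "norm x = 1"
proof -
  obtain y where y: "y \<in> V" "y \<noteq> 0"
    using V(2) subspace_0[OF V(1)] by blast
  show thesis
  proof (rule that)
    show "s (of_real (1 / norm y)) y \<in> V"
      by (rule subspace_scale[OF V(1) y(1)])
    show "norm (s (of_real (1 / norm y)) y) = 1"
      using y(2) by (simp add: norm_scale norm_divide)
  qed
qed

lemma UNIV_nontrivial: "(UNIV :: 'a set) \<noteq> {0}"
  using nonzero by (metis UNIV_I singletonD)

lemma norm_functional_le_numerical_radius: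
  assumes V: "subspace V" and T: "bounded_linear_on s s V T" "T ` V \<subseteq> V"
    and x: "x \<in> V" "norm x = 1"
    and f: "bounded_linear_on s (*) V f" "opnorm_on V f = 1" "f x = 1"
  shows "norm (f (T x)) \<le> numerical_radius s V T"
  unfolding numerical_radius_def
proof (rule cSup_upper)
  show "bdd_above {norm (f (T x)) | x f. x \<in> V \<and> norm x = 1 \<and>
      bounded_linear_on s (*) V f \<and> opnorm_on V f = 1 \<and> f x = 1}"
  proof (rule bdd_aboveI[of _ "opnorm_on V T"], clarify)
    fix x g
    assume *: "x \<in> V" "norm x = 1" "bounded_linear_on s (*) V g" "opnorm_on V g = 1" "g x = 1"
    have "norm (g (T x)) \<le> norm (T x)"
      using norm_le_opnorm_on_mult[OF *(3) norm_mult V, of "T x"] T(2) * by auto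
    also have "\<dots> \<le> opnorm_on V T"
      using norm_le_opnorm_on[OF T(1)] * by simp
    finally show "norm (g (T x)) \<le> opnorm_on V T" .
  qed
qed (use x f in blast)

text \<open>
  A nonzero subspace has a supporting functional, so that the supremum in the definition is taken over
  a nonempty set; the supremum of the empty set of real numbers would carry no information.
\<close>

lemma numerical_radius_least:
  assumes V: "subspace V" "V \<noteq> {0}"
    and le: "\<And>x f. x \<in> V \<Longrightarrow> norm x = 1 \<Longrightarrow> bounded_linear_on s (*) V f \<Longrightarrow>
      opnorm_on V f = 1 \<Longrightarrow> f x = 1 \<Longrightarrow> norm (f (T x)) \<le> M"
  shows "numerical_radius s V T \<le> M"
  unfolding numerical_radius_def
proof (rule cSup_least)
  obtain x where x: "x \<in> V" "norm x = 1"
    using exists_unit_vector_in[OF V] .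
  then obtain f where "bounded_linear_on s (*) V f" "opnorm_on V f = 1" "f x = 1"
    using exists_supporting_functional_on[OF V(1)] by blast
  with x show "{norm (f (T x)) | x f. x \<in> V \<and> norm x = 1 \<and>
      bounded_linear_on s (*) V f \<and> opnorm_on V f = 1 \<and> f x = 1} \<noteq> {}"
    by blast
qed (use le in blast)

text \<open>
  This provides the lower bound without which the infimum in the numerical index would be unspecified.
\<close>

lemma numerical_radius_nonneg:
  assumes V: "subspace V" "V \<noteq> {0}" and T: "bounded_linear_on s s V T" "T ` V \<subseteq> V"
  shows "0 \<le> numerical_radius s V T"
proof -
  obtain x where x: "x \<in> V" "norm x = 1"
    using exists_unit_vector_in[OF V] .
  then obtain f where "bounded_linear_on s (*) V f" "opnorm_on V f = 1" "f x = 1"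
    using exists_supporting_functional_on[OF V(1)] by blast
  then have "norm (f (T x)) \<le> numerical_radius s V T"
    using norm_functional_le_numerical_radius[OF V(1) T x] by blast
  then show ?thesis
    using norm_ge_zero[of "f (T x)"] by linarith
qed

lemma numerical_index_le_numerical_radius:
  assumes "subspace V" "V \<noteq> {0}"
    and "bounded_linear_on s s V T" "T ` V \<subseteq> V" "opnorm_on V T = 1"
  shows "numerical_index s V \<le> numerical_radius s V T"
  unfolding numerical_index_def
  using assms numerical_radius_nonneg[OF assms(1,2)]
  by (intro cInf_lower bdd_belowI[of _ 0]) auto

lemma numerical_index_greatest:
  assumes V: "subspace V" "V \<noteq> {0}"
    and le: "\<And>T. bounded_linear_on s s V T \<Longrightarrow> T ` V \<subseteq> V \<Longrightarrow> opnorm_on V T = 1 \<Longrightarrow>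
      M \<le> numerical_radius s V T"
  shows "M \<le> numerical_index s V"
  unfolding numerical_index_def
proof (rule cInf_greatest)
  obtain x where x: "x \<in> V" "norm x = 1"
    using exists_unit_vector_in[OF V] .
  have bl: "bounded_linear_on s s V (\<lambda>x. x)"
    by (auto simp: bounded_linear_on_def intro: exI[of _ 1])
  have "opnorm_on V (\<lambda>x. x) \<le> 1"
    by (intro opnorm_on_le subspace_0[OF V(1)]) auto
  moreover have "1 \<le> opnorm_on V (\<lambda>x. x)"
    using norm_le_opnorm_on[OF bl x(1)] x(2) by simp
  ultimately show "{numerical_radius s V T | T.
      T ` V \<subseteq> V \<and> bounded_linear_on s s V T \<and> opnorm_on V T = 1} \<noteq> {}"
    using bl by (auto intro!: exI[of _ "\<lambda>x. x"])
qed (use le in blast)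

section \<open>A norm inequality that characterizes the numerical radius\<close>

text \<open>
  A functional \<open>f\<close> that supports the unit vector \<open>x\<close> gives
  \<open>norm (x - b T x) \<ge> norm (1 - b f (T x)) \<ge> 1 - norm b * v\<close>, where \<open>v\<close> is the numerical radius.
\<close>

lemma lower_bound_of_numerical_radius:
  assumes V: "subspace V" and T: "bounded_linear_on s s V T" "T ` V \<subseteq> V" and x: "x \<in> V"
  shows "(1 - norm b * numerical_radius s V T) * norm x \<le> norm (x - s b (T x))"
proof (cases "x = 0")
  case False
  let ?v = "numerical_radius s V T" and ?c = "of_real (1 / norm x) :: 'k"
  define y where "y = s ?c x"
  have y: "y \<in> V" "norm y = 1"
    using V x False by (auto simp: y_def subspace_scale norm_scale norm_divide)
  obtain f where f: "bounded_linear_on s (*) V f" "opnorm_on V f = 1" "f y = 1"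
    using exists_supporting_functional_on[OF V y] .
  have f_le: "norm (f z) \<le> norm z" if "z \<in> V" for z
    using norm_le_opnorm_on_mult[OF f(1) norm_mult V that] f(2) by simp
  have Ty: "T y \<in> V"
    using T(2) y(1) by blast
  have mem: "s (- b) (T y) \<in> V" "y - s b (T y) \<in> V"
    by (simp_all only: subspace_scale[OF V Ty] subspace_diff[OF V y(1) subspace_scale[OF V Ty]])
  have "f (y + s (- b) (T y)) = f y + (- b) * f (T y)"
    using f(1) y(1) Ty mem(1) unfolding bounded_linear_on_def by metis
  then have f_diff: "f (y - s b (T y)) = 1 - b * f (T y)"
    by (simp add: f(3))
  have "norm (b * f (T y)) \<le> norm b * ?v"
    using norm_functional_le_numerical_radius[OF V T y f]
    by (simp add: norm_mult mult_left_mono)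
  then have "1 - norm b * ?v \<le> norm (f (y - s b (T y)))"
    unfolding f_diff using norm_triangle_ineq2[of 1 "b * f (T y)"] by simp
  also have "\<dots> \<le> norm (y - s b (T y))"
    by (rule f_le[OF mem(2)])
  also have "y - s b (T y) = s ?c (x - s b (T x))"
  proof -
    have "T y = s ?c (T x)"
      using T(1) x unfolding y_def bounded_linear_on_def by blast
    then show ?thesis
      by (simp add: y_def scale_right_diff_distrib mult.commute)
  qed
  also have "norm (s ?c (x - s b (T x))) = norm (x - s b (T x)) / norm x"
    unfolding norm_scale by (simp add: norm_divide)
  finally show ?thesis
    using False by (simp add: field_simps)
qed simp

text \<open>
  Lumer's description of the numerical radius by the growth of \<open>norm (I + b T)\<close> for small \<open>b\<close>, in a
  form without suprema and limits. If \<open>v\<close> bounds the numerical radius, then the lower bound above is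
  applied to \<open>x + b T x\<close>: the factor \<open>I - b T\<close> turns it into \<open>x - b\<^sup>2 T\<^sup>2 x\<close>, whose norm exceeds
  that of \<open>x\<close> at most by a term of second order in \<open>b\<close>. Conversely, with \<open>b\<close> of modulus \<open>a\<close> rotated so that
  \<open>b f (T x) = a z\<close> for \<open>z = norm (f (T x))\<close>, a supporting functional gives
  \<open>(1 - a v) (1 + a z) \<le> 1 + a\<^sup>2\<close>, and \<open>z \<le> v\<close> is what the terms of first order in \<open>a\<close> say.

  The right-hand side mentions no functionals, which is why it passes from operators on \<open>X\<close> or \<open>Y\<close>
  to operators on a space of operators.
\<close>

lemma numerical_radius_le_iff:
  assumes V: "subspace V" "V \<noteq> {0}" and T: "bounded_linear_on s s V T" "T ` V \<subseteq> V"
    and T1: "opnorm_on V T \<le> 1"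
  shows "numerical_radius s V T \<le> v \<longleftrightarrow>
    (\<forall>b. \<forall>x\<in>V. (1 - norm b * v) * norm (x + s b (T x)) \<le> (1 + (norm b)\<^sup>2) * norm x)"
proof (intro iffI allI ballI)
  fix b x
  assume v: "numerical_radius s V T \<le> v" and x: "x \<in> V"
  have Tx: "T x \<in> V"
    using T(2) x by blast
  define y where "y = x + s b (T x)"
  have bTx: "s b (T x) \<in> V"
    using V(1) Tx by (rule subspace_scale)
  then have y: "y \<in> V"
    unfolding y_def by (intro subspace_add V(1) x)
  have T_le: "norm (T z) \<le> norm z" if "z \<in> V" for z
    using norm_le_opnorm_on_mult[OF T(1) norm_scale V(1) that]
      mult_right_mono[OF T1 norm_ge_zero[of z]] by simp
  have "(1 - norm b * v) * norm y \<le> (1 - norm b * numerical_radius s V T) * norm y"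
    using v by (intro mult_right_mono) (auto intro: mult_left_mono)
  also have "\<dots> \<le> norm (y - s b (T y))"
    by (rule lower_bound_of_numerical_radius[OF V(1) T y])
  also have "T y = T x + s b (T (T x))"
    unfolding y_def using T(1) x Tx bTx by (simp only: bounded_linear_on_def)
  then have "y - s b (T y) = x - s (b * b) (T (T x))"
    by (simp add: y_def scale_right_distrib)
  also have "norm (x - s (b * b) (T (T x))) \<le> norm x + norm (s (b * b) (T (T x)))"
    by (rule norm_triangle_ineq4)
  also have "\<dots> \<le> norm x + (norm b)\<^sup>2 * norm x"
    using T_le[OF Tx] T_le[OF x]
    by (simp add: norm_scale norm_mult power2_eq_square mult_left_mono)
  finally show "(1 - norm b * v) * norm (x + s b (T x)) \<le> (1 + (norm b)\<^sup>2) * norm x"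
    by (simp add: y_def algebra_simps)
next
  assume bound: "\<forall>b. \<forall>x\<in>V. (1 - norm b * v) * norm (x + s b (T x)) \<le> (1 + (norm b)\<^sup>2) * norm x"
  show "numerical_radius s V T \<le> v"
  proof (rule numerical_radius_least[OF V])
    fix x f
    assume x: "x \<in> V" "norm x = 1"
      and f: "bounded_linear_on s (*) V f" "opnorm_on V f = 1" "f x = 1"
    have Tx: "T x \<in> V"
      using T(2) x by blast
    obtain c where c: "norm c = 1" "c * f (T x) = of_real (norm (f (T x)))"
      by (rule obtain_unimodular_rotation)
    define z where "z = norm (f (T x))"
    \<comment> \<open>What remains of \<open>(1 - a v) (1 + a z) \<le> 1 + a\<^sup>2\<close> after division by \<open>a\<close>.\<close>
    have main: "z - v \<le> a * (1 + v * z)" if "a > 0" "0 < 1 - a * v" for a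
    proof -
      define b where "b = of_real a * c"
      have nb: "norm b = a"
        using that(1) c(1) by (simp add: b_def norm_mult)
      have bTx: "s b (T x) \<in> V"
        using V(1) Tx by (rule subspace_scale)
      have "f (x + s b (T x)) = f x + b * f (T x)"
        using f(1) x(1) Tx bTx by (simp only: bounded_linear_on_def)
      also have "\<dots> = of_real (1 + a * z)"
        using c(2) by (simp add: f(3) b_def z_def mult.assoc)
      finally have "norm (f (x + s b (T x))) = 1 + a * z"
        using that(1) by (simp add: z_def norm_of_real del: of_real_add)
      moreover have "norm (f (x + s b (T x))) \<le> norm (x + s b (T x))"
        using norm_le_opnorm_on_mult[OF f(1) norm_mult V(1) subspace_add[OF V(1) x(1) bTx]] f(2)
        by simp
      ultimately have "(1 - a * v) * (1 + a * z) \<le> (1 - a * v) * norm (x + s b (T x))"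
        using that(2) by (intro mult_left_mono) auto
      also have "\<dots> \<le> 1 + a\<^sup>2"
        using bound[rule_format, OF x(1), of b] x(2) nb by simp
      finally have "a * (z - v) \<le> a * (a * (1 + v * z))"
        by (simp add: algebra_simps power2_eq_square)
      with that(1) show ?thesis by simp
    qed
    \<comment> \<open>Letting \<open>a\<close> tend to \<open>0\<close> from the right gives \<open>z \<le> v\<close>.\<close>
    have "((\<lambda>a. 1 - a * v) \<longlongrightarrow> 1 - 0 * v) (at_right 0)"
      by (intro tendsto_intros)
    then have "\<forall>\<^sub>F a in at_right 0. 0 < 1 - a * v"
      by (rule order_tendstoD(1)) simp
    then have "\<forall>\<^sub>F a in at_right 0. z - v \<le> a * (1 + v * z)"
      using eventually_at_right_less[of "0::real"] by eventually_elim (rule main)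
    moreover have "((\<lambda>a. a * (1 + v * z)) \<longlongrightarrow> 0 * (1 + v * z)) (at_right 0)"
      by (intro tendsto_intros)
    ultimately have "z - v \<le> 0 * (1 + v * z)"
      by (intro tendsto_lowerbound[where F = "at_right (0::real)"]) auto
    then show "norm (f (T x)) \<le> v"
      by (simp add: z_def)
  qed
qed

end

section \<open>Operator spaces and operator ideals\<close>

lemma (in banach_over) bounded_linear_scale: "bounded_linear (s c)"
  by (rule bounded_linear_intro[of _ "norm c"])
    (auto simp: scale_right_distrib scaleR_eq norm_scale mult.commute)

lemma op_scale_apply:
  assumes "banach_over t"
  shows "blinfun_apply (op_scale t c T) x = t c (blinfun_apply T x)"
proof -
  have "bounded_linear (\<lambda>x. t c (blinfun_apply T x))"
    by (rule bounded_linear_compose[OF banach_over.bounded_linear_scale[OF assms]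
          blinfun.bounded_linear_right])
  then show ?thesis
    by (simp add: op_scale_def bounded_linear_Blinfun_apply)
qed

text \<open>
  The operators \<open>f \<otimes> y\<close> lie in every operator ideal. They show that an ideal is not \<open>{0}\<close>, and they are
  the test operators that bound the norms of compositions from below.
\<close>

lemma rank_one_operator:
  fixes y :: "'b::banach" and f :: "'a::banach \<Rightarrow> 'k::real_or_complex"
  assumes "banach_over sX" and "banach_over sY"
    and add: "\<And>x x'. f (x + x') = f x + f x'" and scale: "\<And>c x. f (sX c x) = c * f x"
    and le: "\<And>x. norm (f x) \<le> norm x"
  obtains T where "T \<in> bounded_ops sX sY" and "finite_rank sY T"
    and "\<And>x. blinfun_apply T x = sY (f x) y" and "norm T \<le> norm y"
proof -
  interpret X: banach_over sX by fact
  interpret Y: banach_over sY by fact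
  have le_y: "norm (sY (f x) y) \<le> norm x * norm y" for x
    using le[of x] by (simp add: Y.norm_scale mult_right_mono)
  have "bounded_linear (\<lambda>x. sY (f x) y)"
  proof (rule bounded_linear_intro[OF _ _ le_y])
    show "sY (f (r *\<^sub>R x)) y = r *\<^sub>R sY (f x) y" for r x
      by (simp add: X.scaleR_eq Y.scaleR_eq scale)
  qed (simp add: add Y.scale_left_distrib)
  then have apply_T: "blinfun_apply (Blinfun (\<lambda>x. sY (f x) y)) x = sY (f x) y" for x
    by (simp add: bounded_linear_Blinfun_apply)
  show thesis
  proof (rule that[OF _ _ apply_T])
    show "norm (Blinfun (\<lambda>x. sY (f x) y)) \<le> norm y"
      using le_y by (intro norm_blinfun_bound) (auto simp: apply_T mult.commute)
    show "finite_rank sY (Blinfun (\<lambda>x. sY (f x) y))"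
      unfolding finite_rank_def
      by (intro exI[of _ "{y}"]) (auto simp: apply_T intro: Y.span_scale Y.span_base)
  qed (simp add: bounded_ops_def apply_T scale)
qed

lemma exists_norm_one_functional:
  fixes s :: "'k::real_or_complex \<Rightarrow> 'a::banach \<Rightarrow> 'a"
  assumes "banach_over s"
  obtains f x where "\<And>x y. f (x + y) = f x + f y" and "\<And>c x. f (s c x) = c * f x"
    and "\<And>x. norm (f x) \<le> norm x" and "norm x = 1" and "f x = 1"
proof -
  interpret banach_over s by fact
  obtain x :: 'a where x: "norm x = 1"
    using exists_unit_vector_in[OF subspace_UNIV UNIV_nontrivial] by blast
  obtain f where f: "\<And>x y. f (x + y) = f x + f y" "\<And>c x. f (s c x) = c * f x"
      "\<And>x. norm (f x) \<le> norm x" "f x = of_real (norm x)"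
    using exists_norming_functional[of x] by blast
  show thesis
    by (rule that[of f x]) (simp_all add: f x)
qed

text \<open>
  The space of all bounded real-linear operators is a Banach space over \<open>'k\<close>, with the scalars acting
  on the values. Operator ideals are treated as subspaces of it, so that the results about a subspace
  of a Banach space over \<open>'k\<close>, in particular the existence of supporting functionals, apply to them.
\<close>

lemma banach_over_op_scale:
  fixes sX :: "'k::real_or_complex \<Rightarrow> 'a::banach \<Rightarrow> 'a" and sY :: "'k \<Rightarrow> 'b::banach \<Rightarrow> 'b"
  assumes X: "banach_over sX" and Y: "banach_over sY"
  shows "banach_over (op_scale sY :: 'k \<Rightarrow> ('a \<Rightarrow>\<^sub>L 'b) \<Rightarrow> ('a \<Rightarrow>\<^sub>L 'b))"
proof -
  interpret Y: banach_over sY by fact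
  note [simp] = op_scale_apply[OF Y]
  have norm_le: "norm (op_scale sY c T) \<le> norm c * norm T" for c and T :: "'a \<Rightarrow>\<^sub>L 'b"
  proof (rule norm_blinfun_bound)
    show "norm (blinfun_apply (op_scale sY c T) x) \<le> norm c * norm T * norm x" for x
      using norm_blinfun[of T x] by (simp add: Y.norm_scale mult.assoc mult_left_mono)
  qed simp
  have norm_ge: "norm c * norm T \<le> norm (op_scale sY c T)" for c and T :: "'a \<Rightarrow>\<^sub>L 'b"
  proof (cases "c = 0")
    case False
    have "T = op_scale sY (inverse c) (op_scale sY c T)"
      using False by (intro blinfun_eqI) simp
    then have "norm T \<le> norm (inverse c) * norm (op_scale sY c T)"
      by (metis norm_le)
    with False show ?thesis
      by (simp add: nonzero_norm_inverse norm_divide field_simps)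
  qed simp
  obtain f x where f: "\<And>x y. f (x + y) = f x + f y" "\<And>c x. f (sX c x) = c * f x"
      "\<And>x. norm (f x) \<le> norm x" "f x = 1"
    using exists_norm_one_functional[OF X] by metis
  obtain y :: 'b where "y \<noteq> 0"
    using Y.nonzero by blast
  obtain T :: "'a \<Rightarrow>\<^sub>L 'b" where "\<And>x. blinfun_apply T x = sY (f x) y"
    using rank_one_operator[OF X Y f(1-3)] by metis
  then have "T \<noteq> 0"
    using f(4) \<open>y \<noteq> 0\<close> by (metis Y.scale_one zero_blinfun.rep_eq)
  then have "\<exists>T :: 'a \<Rightarrow>\<^sub>L 'b. T \<noteq> 0" ..
  then show ?thesis
    by unfold_locales
      (auto intro!: blinfun_eqI antisym norm_le norm_ge
        simp: blinfun.add_left blinfun.scaleR_left Y.scale_right_distrib Y.scale_left_distrib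
          Y.scale_of_real)
qed

text \<open>
  Thus the inequality for \<open>\<L>(X,Y)\<close> is an instance of the one for operator ideals.
\<close>

lemma operator_ideal_bounded_ops:
  fixes sX :: "'k::real_or_complex \<Rightarrow> 'a::banach \<Rightarrow> 'a" and sY :: "'k \<Rightarrow> 'b::banach \<Rightarrow> 'b"
  assumes X: "banach_over sX" and Y: "banach_over sY"
  shows "operator_ideal sX sY (bounded_ops sX sY)"
proof -
  interpret Y: banach_over sY by fact
  interpret L: banach_over "op_scale sY :: 'k \<Rightarrow> ('a \<Rightarrow>\<^sub>L 'b) \<Rightarrow> ('a \<Rightarrow>\<^sub>L 'b)"
    by (rule banach_over_op_scale[OF X Y])
  have "bounded_ops sX sY = (\<Inter>c. \<Inter>x. {T. blinfun_apply T (sX c x) = sY c (blinfun_apply T x)})"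
    by (auto simp: bounded_ops_def)
  also have "closed \<dots>"
    by (intro closed_INT ballI closed_Collect_eq bounded_linear.continuous_on[OF Y.bounded_linear_scale]
        continuous_intros)
  finally have "closed (bounded_ops sX sY)" .
  moreover have "L.subspace (bounded_ops sX sY)"
    by (intro L.subspaceI)
      (auto simp: bounded_ops_def blinfun.add_left op_scale_apply[OF Y] Y.scale_right_distrib
        mult.commute)
  ultimately show ?thesis
    by (auto simp: operator_ideal_def bounded_ops_def)
qed

lemma operator_of_bounded_linear_on:
  assumes "banach_over s" and S: "bounded_linear_on s s UNIV S"
  obtains A where "A \<in> bounded_ops s s" and "blinfun_apply A = S"
proof -
  interpret banach_over s by fact
  obtain B where B: "\<And>x. norm (S x) \<le> B * norm x"
    using S unfolding bounded_linear_on_def by blast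
  have "bounded_linear S"
    using S B by (intro bounded_linear_intro[of _ B])
      (auto simp: bounded_linear_on_def scaleR_eq mult.commute)
  then have "blinfun_apply (Blinfun S) = S"
    by (rule bounded_linear_Blinfun_apply)
  then show thesis
    using S by (intro that[of "Blinfun S"]) (auto simp: bounded_ops_def bounded_linear_on_def)
qed

lemma id_blinfun_in_bounded_ops: "id_blinfun \<in> bounded_ops s s"
  by (simp add: bounded_ops_def)

text \<open>
  If every estimate for \<open>I + b S\<close> also holds for \<open>I + b \<Phi>\<close>, then the numerical radius of \<open>\<Phi>\<close> is at
  most that of \<open>S\<close>, because the numerical radius is determined by such estimates. The factor \<open>k\<close> is
  restricted to be nonnegative so that it can be moved into an operator norm; for negative \<open>k\<close> the
  estimate needed here is trivial.
\<close>

lemma (in banach_over) numerical_index_le_of_transfer: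
  assumes W: "banach_over t" "module.subspace t W" "W \<noteq> {0}"
    and S: "bounded_linear_on s s UNIV S" "opnorm_on UNIV S = 1"
    and \<Phi>: "bounded_linear_on t t W \<Phi>" "\<Phi> ` W \<subseteq> W" "opnorm_on W \<Phi> = 1"
    and transfer: "\<And>b w k l. w \<in> W \<Longrightarrow> 0 \<le> k \<Longrightarrow> 0 \<le> l \<Longrightarrow>
      (\<And>x. k * norm (x + s b (S x)) \<le> l * norm x) \<Longrightarrow> k * norm (w + t b (\<Phi> w)) \<le> l * norm w"
  shows "numerical_index t W \<le> numerical_radius s UNIV S"
proof -
  interpret W: banach_over t by fact
  let ?v = "numerical_radius s UNIV S"
  have bound: "(1 - norm b * ?v) * norm (x + s b (S x)) \<le> (1 + (norm b)\<^sup>2) * norm x" for b x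
    using numerical_radius_le_iff[OF subspace_UNIV UNIV_nontrivial, of S ?v] S by simp
  have "(1 - norm b * ?v) * norm (w + t b (\<Phi> w)) \<le> (1 + (norm b)\<^sup>2) * norm w" if "w \<in> W" for b w
  proof (cases "0 \<le> 1 - norm b * ?v")
    case True
    then show ?thesis
      using bound by (intro transfer that) auto
  next
    case False
    then have "(1 - norm b * ?v) * norm (w + t b (\<Phi> w)) \<le> 0"
      by (intro mult_nonpos_nonneg) auto
    also have "0 \<le> (1 + (norm b)\<^sup>2) * norm w"
      by simp
    finally show ?thesis .
  qed
  then have "numerical_radius t W \<Phi> \<le> ?v"
    using W.numerical_radius_le_iff[OF W(2,3) \<Phi>(1,2)] \<Phi>(3) by simp
  then show ?thesis
    using W.numerical_index_le_numerical_radius[OF W(2,3) \<Phi>] by linarith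
qed

context
  fixes sX :: "'k::real_or_complex \<Rightarrow> 'a::banach \<Rightarrow> 'a"
    and sY :: "'k \<Rightarrow> 'b::banach \<Rightarrow> 'b"
    and Z :: "('a \<Rightarrow>\<^sub>L 'b) set"
  assumes X: "banach_over sX" and Y: "banach_over sY" and Z: "operator_ideal sX sY Z"
begin

interpretation X: banach_over sX by (rule X)
interpretation Y: banach_over sY by (rule Y)
interpretation L: banach_over "op_scale sY :: 'k \<Rightarrow> ('a \<Rightarrow>\<^sub>L 'b) \<Rightarrow> ('a \<Rightarrow>\<^sub>L 'b)"
  by (rule banach_over_op_scale[OF X Y])

lemma ideal_subspace: "L.subspace Z"
  using Z by (simp add: operator_ideal_def)

lemma ideal_compose:
  "A \<in> bounded_ops sY sY \<Longrightarrow> T \<in> Z \<Longrightarrow> B \<in> bounded_ops sX sX \<Longrightarrow> A o\<^sub>L T o\<^sub>L B \<in> Z"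
  using Z by (simp add: operator_ideal_def)

lemma ideal_linear: "T \<in> Z \<Longrightarrow> blinfun_apply T (sX c x) = sY c (blinfun_apply T x)"
  using Z by (auto simp: operator_ideal_def bounded_ops_def)

lemma ideal_rank_one:
  fixes f :: "'a \<Rightarrow> 'k" and y :: 'b
  assumes "\<And>x x'. f (x + x') = f x + f x'" and "\<And>c x. f (sX c x) = c * f x"
    and "\<And>x. norm (f x) \<le> norm x"
  obtains T where "T \<in> Z" and "\<And>x. blinfun_apply T x = sY (f x) y" and "norm T \<le> norm y"
proof -
  obtain T where T: "T \<in> bounded_ops sX sY" "finite_rank sY T"
      "\<And>x. blinfun_apply T x = sY (f x) y" "norm T \<le> norm y"
    using rank_one_operator[OF X Y assms, where y = y] by blast
  moreover have "T \<in> Z"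
    using T(1,2) Z by (auto simp: operator_ideal_def)
  ultimately show thesis
    by (intro that)
qed

lemma ideal_nontrivial: "Z \<noteq> {0}"
proof -
  obtain f x where f: "\<And>x y. f (x + y) = f x + f y" "\<And>c x. f (sX c x) = c * f x"
      "\<And>x. norm (f x) \<le> norm x" "f x = 1"
    using exists_norm_one_functional[OF X] by metis
  obtain y :: 'b where "y \<noteq> 0"
    using Y.nonzero by blast
  obtain T where T: "T \<in> Z" "\<And>x. blinfun_apply T x = sY (f x) y"
    using ideal_rank_one[OF f(1-3)] by metis
  then have "T \<noteq> 0"
    using f(4) \<open>y \<noteq> 0\<close> by (metis Y.scale_one zero_blinfun.rep_eq)
  with T(1) show ?thesis by blast
qed

text \<open>
  For \<open>S\<close> on \<open>X\<close> the operator \<open>\<Phi> T = T \<circ> S\<close> on the ideal has the norm of \<open>S\<close>: if \<open>f\<close> is norming for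
  \<open>S x\<close> and \<open>y\<close> is a unit vector, then \<open>\<Phi> (f \<otimes> y)\<close> maps \<open>x\<close> to \<open>norm (S x) y\<close>. Estimates are transferred
  through \<open>T + b (\<Phi> T) = T \<circ> (I + b S)\<close>, which uses that \<open>T\<close> is linear over the scalar field.
\<close>

lemma numerical_index_ideal_le_domain: "numerical_index (op_scale sY) Z \<le> numerical_index sX UNIV"
proof (rule X.numerical_index_greatest[OF X.subspace_UNIV X.UNIV_nontrivial])
  fix S
  assume S: "bounded_linear_on sX sX UNIV S" "opnorm_on UNIV S = 1"
  obtain A where A: "A \<in> bounded_ops sX sX" "blinfun_apply A = S"
    using operator_of_bounded_linear_on[OF X S(1)] .
  have S_le: "norm (S x) \<le> norm x" for x
    using X.norm_le_opnorm_on_mult[OF S(1) X.norm_scale, of x] S(2) by simp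
  define \<Phi> where "\<Phi> T = T o\<^sub>L A" for T :: "'a \<Rightarrow>\<^sub>L 'b"
  have \<Phi>_apply: "blinfun_apply (\<Phi> T) x = blinfun_apply T (S x)" for T x
    by (simp add: \<Phi>_def A(2))
  have \<Phi>_le: "norm (\<Phi> T) \<le> norm T" for T
  proof (rule norm_blinfun_bound)
    show "norm (blinfun_apply (\<Phi> T) x) \<le> norm T * norm x" for x
      using norm_blinfun[of T "S x"] mult_left_mono[OF S_le[of x] norm_ge_zero[of T]]
      by (simp add: \<Phi>_apply)
  qed simp
  have \<Phi>_lin: "bounded_linear_on (op_scale sY) (op_scale sY) Z \<Phi>"
    unfolding bounded_linear_on_def using \<Phi>_le
    by (auto intro!: blinfun_eqI exI[of _ 1] simp: \<Phi>_apply blinfun.add_left op_scale_apply[OF Y])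
  have \<Phi>_Z: "\<Phi> ` Z \<subseteq> Z"
  proof clarify
    fix T
    assume "T \<in> Z"
    then have "id_blinfun o\<^sub>L T o\<^sub>L A \<in> Z"
      by (rule ideal_compose[OF id_blinfun_in_bounded_ops _ A(1)])
    also have "id_blinfun o\<^sub>L T o\<^sub>L A = \<Phi> T"
      by (intro blinfun_eqI) (simp add: \<Phi>_def)
    finally show "\<Phi> T \<in> Z" .
  qed
  have "opnorm_on UNIV S \<le> opnorm_on Z \<Phi>"
    unfolding opnorm_on_def[of UNIV]
  proof (rule cSUP_least)
    fix x :: 'a
    assume x: "x \<in> {x \<in> UNIV. norm x \<le> 1}"
    obtain f where f: "\<And>x y. f (x + y) = f x + f y" "\<And>c x. f (sX c x) = c * f x"
        "\<And>x. norm (f x) \<le> norm x" "f (S x) = of_real (norm (S x))"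
      using X.exists_norming_functional[of "S x"] by blast
    obtain y :: 'b where y: "norm y = 1"
      using exists_norm_one_functional[OF Y] by metis
    obtain T where T: "T \<in> Z" "\<And>x. blinfun_apply T x = sY (f x) y" "norm T \<le> norm y"
      using ideal_rank_one[OF f(1-3), where y = y] by blast
    have "norm (S x) = norm (blinfun_apply (\<Phi> T) x)"
      by (simp add: \<Phi>_apply T(2) f(4) Y.norm_scale y)
    also have "\<dots> \<le> norm (\<Phi> T) * norm x"
      by (rule norm_blinfun)
    also have "\<dots> \<le> norm (\<Phi> T)"
      using x by (simp add: mult_left_le)
    also have "\<dots> \<le> opnorm_on Z \<Phi>"
      using T y by (intro norm_le_opnorm_on[OF \<Phi>_lin]) auto
    finally show "norm (S x) \<le> opnorm_on Z \<Phi>" .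
  qed (auto intro: exI[of _ 0])
  moreover have "opnorm_on Z \<Phi> \<le> 1"
    using \<Phi>_le L.subspace_0[OF ideal_subspace] by (intro opnorm_on_le) auto
  ultimately have \<Phi>_1: "opnorm_on Z \<Phi> = 1"
    using S(2) by simp
  show "numerical_index (op_scale sY) Z \<le> numerical_radius sX UNIV S"
  proof (rule X.numerical_index_le_of_transfer[OF L.banach_over_axioms ideal_subspace
        ideal_nontrivial S \<Phi>_lin \<Phi>_Z \<Phi>_1])
    fix b :: 'k and T k l
    assume T: "T \<in> Z" and k: "0 \<le> (k::real)" and l: "0 \<le> (l::real)"
      and le: "\<And>x. k * norm (x + sX b (S x)) \<le> l * norm x"
    \<comment> \<open>The operator norm is estimated pointwise, through \<open>T x + b (\<Phi> T x) = T (x + b S x)\<close>.\<close>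
    have "norm (k *\<^sub>R (T + op_scale sY b (\<Phi> T))) \<le> l * norm T"
    proof (rule norm_blinfun_bound)
      fix x
      have "norm (blinfun_apply (k *\<^sub>R (T + op_scale sY b (\<Phi> T))) x) =
          k * norm (blinfun_apply T (x + sX b (S x)))"
        using k by (simp add: blinfun.add_left blinfun.add_right blinfun.scaleR_left
            op_scale_apply[OF Y] \<Phi>_apply ideal_linear[OF T])
      also have "\<dots> \<le> k * (norm T * norm (x + sX b (S x)))"
        using k norm_blinfun by (intro mult_left_mono)
      also have "\<dots> \<le> norm T * (l * norm x)"
        using mult_left_mono[OF le[of x] norm_ge_zero[of T]] by (simp add: algebra_simps)
      finally show "norm (blinfun_apply (k *\<^sub>R (T + op_scale sY b (\<Phi> T))) x) \<le> l * norm T * norm x"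
        by (simp add: algebra_simps)
    qed (use l in simp)
    then show "k * norm (T + op_scale sY b (\<Phi> T)) \<le> l * norm T"
      using k by simp
  qed
qed

text \<open>
  For \<open>S\<close> on \<open>Y\<close> the same argument works with \<open>\<Phi> T = S \<circ> T\<close>, where now
  \<open>T + b (\<Phi> T) = (I + b S) \<circ> T\<close>, and \<open>\<Phi>\<close> has the norm of \<open>S\<close> because \<open>\<Phi> (f \<otimes> y)\<close> maps \<open>x\<close> to
  \<open>S y\<close> whenever \<open>f x = 1\<close>.
\<close>

lemma numerical_index_ideal_le_codomain: "numerical_index (op_scale sY) Z \<le> numerical_index sY UNIV"
proof (rule Y.numerical_index_greatest[OF Y.subspace_UNIV Y.UNIV_nontrivial])
  fix S
  assume S: "bounded_linear_on sY sY UNIV S" "opnorm_on UNIV S = 1"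
  obtain A where A: "A \<in> bounded_ops sY sY" "blinfun_apply A = S"
    using operator_of_bounded_linear_on[OF Y S(1)] .
  have S_le: "norm (S y) \<le> norm y" for y
    using Y.norm_le_opnorm_on_mult[OF S(1) Y.norm_scale, of y] S(2) by simp
  define \<Phi> where "\<Phi> T = A o\<^sub>L T" for T :: "'a \<Rightarrow>\<^sub>L 'b"
  have \<Phi>_apply: "blinfun_apply (\<Phi> T) x = S (blinfun_apply T x)" for T x
    by (simp add: \<Phi>_def A(2))
  have \<Phi>_le: "norm (\<Phi> T) \<le> norm T" for T
  proof (rule norm_blinfun_bound)
    show "norm (blinfun_apply (\<Phi> T) x) \<le> norm T * norm x" for x
      using S_le[of "blinfun_apply T x"] norm_blinfun[of T x] by (simp add: \<Phi>_apply)
  qed simp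
  have S_lin: "S (x + y) = S x + S y" "S (sY c x) = sY c (S x)" for x y c
    using S(1) by (auto simp: bounded_linear_on_def)
  have \<Phi>_lin: "bounded_linear_on (op_scale sY) (op_scale sY) Z \<Phi>"
    unfolding bounded_linear_on_def using \<Phi>_le
    by (auto intro!: blinfun_eqI exI[of _ 1]
        simp: \<Phi>_apply blinfun.add_left op_scale_apply[OF Y] S_lin)
  have \<Phi>_Z: "\<Phi> ` Z \<subseteq> Z"
  proof clarify
    fix T
    assume "T \<in> Z"
    then have "A o\<^sub>L T o\<^sub>L id_blinfun \<in> Z"
      by (rule ideal_compose[OF A(1) _ id_blinfun_in_bounded_ops])
    also have "A o\<^sub>L T o\<^sub>L id_blinfun = \<Phi> T"
      by (intro blinfun_eqI) (simp add: \<Phi>_def)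
    finally show "\<Phi> T \<in> Z" .
  qed
  have "opnorm_on UNIV S \<le> opnorm_on Z \<Phi>"
    unfolding opnorm_on_def[of UNIV]
  proof (rule cSUP_least)
    fix y :: 'b
    assume y: "y \<in> {y \<in> UNIV. norm y \<le> 1}"
    obtain f x where f: "\<And>x y. f (x + y) = f x + f y" "\<And>c x. f (sX c x) = c * f x"
        "\<And>x. norm (f x) \<le> norm x" "norm x = 1" "f x = 1"
      using exists_norm_one_functional[OF X] by blast
    obtain T where T: "T \<in> Z" "\<And>x. blinfun_apply T x = sY (f x) y" "norm T \<le> norm y"
      using ideal_rank_one[OF f(1-3), where y = y] by blast
    have "norm (S y) = norm (blinfun_apply (\<Phi> T) x)"
      by (simp add: \<Phi>_apply T(2) f(5))
    also have "\<dots> \<le> norm (\<Phi> T)"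
      using norm_blinfun[of "\<Phi> T" x] f(4) by simp
    also have "\<dots> \<le> opnorm_on Z \<Phi>"
      using T y by (intro norm_le_opnorm_on[OF \<Phi>_lin]) auto
    finally show "norm (S y) \<le> opnorm_on Z \<Phi>" .
  qed (auto intro: exI[of _ 0])
  moreover have "opnorm_on Z \<Phi> \<le> 1"
    using \<Phi>_le L.subspace_0[OF ideal_subspace] by (intro opnorm_on_le) auto
  ultimately have \<Phi>_1: "opnorm_on Z \<Phi> = 1"
    using S(2) by simp
  show "numerical_index (op_scale sY) Z \<le> numerical_radius sY UNIV S"
  proof (rule Y.numerical_index_le_of_transfer[OF L.banach_over_axioms ideal_subspace
        ideal_nontrivial S \<Phi>_lin \<Phi>_Z \<Phi>_1])
    fix b :: 'k and T k l
    assume k: "0 \<le> (k::real)" and l: "0 \<le> (l::real)"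
      and le: "\<And>y. k * norm (y + sY b (S y)) \<le> l * norm y"
    have "norm (k *\<^sub>R (T + op_scale sY b (\<Phi> T))) \<le> l * norm T"
    proof (rule norm_blinfun_bound)
      fix x
      let ?y = "blinfun_apply T x"
      have "norm (blinfun_apply (k *\<^sub>R (T + op_scale sY b (\<Phi> T))) x) = k * norm (?y + sY b (S ?y))"
        using k by (simp add: blinfun.add_left blinfun.scaleR_left op_scale_apply[OF Y] \<Phi>_apply)
      also have "\<dots> \<le> l * norm ?y"
        by (rule le)
      also have "\<dots> \<le> l * (norm T * norm x)"
        using l norm_blinfun by (intro mult_left_mono)
      finally show "norm (blinfun_apply (k *\<^sub>R (T + op_scale sY b (\<Phi> T))) x) \<le> l * norm T * norm x"
        by (simp add: mult.assoc)
    qed (use l in simp)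
    then show "k * norm (T + op_scale sY b (\<Phi> T)) \<le> l * norm T"
      using k by simp
  qed
qed

end

theorem proposition2p1:
  fixes sX :: "'k::real_or_complex \<Rightarrow> 'a::banach \<Rightarrow> 'a"
    and sY :: "'k \<Rightarrow> 'b::banach \<Rightarrow> 'b"
  assumes "banach_over sX" and "banach_over sY"
  shows "numerical_index (op_scale sY) (bounded_ops sX sY)
           \<le> min (numerical_index sX UNIV) (numerical_index sY UNIV) \<and>
         (\<forall>Z. operator_ideal sX sY Z \<longrightarrow>
           numerical_index (op_scale sY) Z
             \<le> min (numerical_index sX UNIV) (numerical_index sY UNIV))"
proof -
  have "numerical_index (op_scale sY) Z \<le> min (numerical_index sX UNIV) (numerical_index sY UNIV)"
    if "operator_ideal sX sY Z" for Z
    using numerical_index_ideal_le_domain[OF assms that]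
      numerical_index_ideal_le_codomain[OF assms that] by simp
  then show ?thesis
    using operator_ideal_bounded_ops[OF assms] by blast
qed

end
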